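(* Let the signature consist of binary relation symbols $L,R,U,D$ together with finitely many unary relation symbols. (1) There is no first-order sentence $\phi$ over such a signature such that the restrictions to $\{L,R,U,D\}$ of the finite models of $\phi$ are, up to isomorphism, exactly all rectangular grids. (2) Moreover, there is no first-order sentence $\phi$ over such a signature such that every finite model of $\phi$ restricted to $\{L,R,U,D\}$ is a rectangular grid and there exists $y^*$ such that for every $x^*$ some finite model of $\phi$ restricts to the rectangular grid $\{0,\ldots,x^*\}\times\{0,\ldots,y^*\}$.
   Context: A rectangular grid is a structure $(V,L,R,U,D)$ with $V=\{0,\ldots,x^*\}\times\{0,\ldots,y^*\}$ for integers $x^*,y^*\ge0$, where the binary relations hold exactly in the cases (whenever both vertices exist) $L((x,y),(x-1,y))$, $R((x,y),(x+1,y))$, $U((x,y),(x,y-1))$, $D((x,y),(x,y+1))$. *)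

theory Defs
  imports Main
begin

datatype dir = L | R | U | D

text \<open>First-order formulas with equality. Variables are named by natural numbers; the unary
  relation symbols are named by elements of \<open>'p\<close>.\<close>

datatype 'p fm =
    Eq nat nat
  | Rel dir nat nat
  | Pred 'p nat
  | Neg "'p fm"
  | Conj "'p fm" "'p fm"
  | Disj "'p fm" "'p fm"
  | Exists nat "'p fm"
  | Forall nat "'p fm"

primrec fv :: "'p fm \<Rightarrow> nat set" where
  "fv (Eq i j) = {i, j}"
| "fv (Rel d i j) = {i, j}"
| "fv (Pred p i) = {i}"
| "fv (Neg \<phi>) = fv \<phi>"
| "fv (Conj \<phi> \<psi>) = fv \<phi> \<union> fv \<psi>"
| "fv (Disj \<phi> \<psi>) = fv \<phi> \<union> fv \<psi>"
| "fv (Exists i \<phi>) = fv \<phi> - {i}"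
| "fv (Forall i \<phi>) = fv \<phi> - {i}"

text \<open>\<open>set_fm \<phi>\<close>, generated by the datatype, is the set of unary symbols occurring in \<open>\<phi>\<close>; thus
  \<open>P\<close> is the set of unary symbols of the signature.\<close>

definition sentence :: "'p set \<Rightarrow> 'p fm \<Rightarrow> bool" where
  "sentence P \<phi> \<longleftrightarrow> set_fm \<phi> \<subseteq> P \<and> fv \<phi> = {}"

record 'a lrud =
  univ :: "'a set"
  rel :: "dir \<Rightarrow> ('a \<times> 'a) set"

record ('a, 'p) lrud_pred = "'a lrud" +
  pred :: "'p \<Rightarrow> 'a set"

text \<open>The value of \<open>pred M\<close> outside \<open>P\<close> is irrelevant to the truth of formulas over \<open>P\<close>.\<close>

definition is_structure :: "'p set \<Rightarrow> ('a, 'p) lrud_pred \<Rightarrow> bool" where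
  "is_structure P M \<longleftrightarrow> univ M \<noteq> {} \<and> (\<forall>d. rel M d \<subseteq> univ M \<times> univ M) \<and>
     (\<forall>p\<in>P. pred M p \<subseteq> univ M)"

primrec sat :: "('a, 'p) lrud_pred \<Rightarrow> (nat \<Rightarrow> 'a) \<Rightarrow> 'p fm \<Rightarrow> bool" where
  "sat M v (Eq i j) \<longleftrightarrow> v i = v j"
| "sat M v (Rel d i j) \<longleftrightarrow> (v i, v j) \<in> rel M d"
| "sat M v (Pred p i) \<longleftrightarrow> v i \<in> pred M p"
| "sat M v (Neg \<phi>) \<longleftrightarrow> \<not> sat M v \<phi>"
| "sat M v (Conj \<phi> \<psi>) \<longleftrightarrow> sat M v \<phi> \<and> sat M v \<psi>"
| "sat M v (Disj \<phi> \<psi>) \<longleftrightarrow> sat M v \<phi> \<or> sat M v \<psi>"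
| "sat M v (Exists i \<phi>) \<longleftrightarrow> (\<exists>a\<in>univ M. sat M (v(i := a)) \<phi>)"
| "sat M v (Forall i \<phi>) \<longleftrightarrow> (\<forall>a\<in>univ M. sat M (v(i := a)) \<phi>)"

text \<open>Universes are subsets of a type \<open>'a\<close>. If \<open>'a\<close> is infinite, every finite structure has an
  isomorphic copy over \<open>'a\<close>, so quantifying over models of this one type loses nothing.\<close>

definition finite_model :: "'p set \<Rightarrow> 'p fm \<Rightarrow> ('a, 'p) lrud_pred \<Rightarrow> bool" where
  "finite_model P \<phi> M \<longleftrightarrow> is_structure P M \<and> finite (univ M) \<and>
     (\<forall>v. range v \<subseteq> univ M \<longrightarrow> sat M v \<phi>)"

definition restriction :: "('a, 'p) lrud_pred \<Rightarrow> 'a lrud" where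
  "restriction M = \<lparr>univ = univ M, rel = rel M\<rparr>"

definition isomorphic :: "'a lrud \<Rightarrow> 'b lrud \<Rightarrow> bool" where
  "isomorphic A B \<longleftrightarrow> (\<exists>f. bij_betw f (univ A) (univ B) \<and>
     (\<forall>d. \<forall>a\<in>univ A. \<forall>b\<in>univ A. (a, b) \<in> rel A d \<longleftrightarrow> (f a, f b) \<in> rel B d))"

text \<open>\<open>step d v w\<close>: the vertex \<open>w\<close> is the neighbour of \<open>v\<close> in direction \<open>d\<close>. The second coordinate
  grows downwards. Successors replace predecessors to avoid truncated subtraction.\<close>

fun step :: "dir \<Rightarrow> nat \<times> nat \<Rightarrow> nat \<times> nat \<Rightarrow> bool" where
  "step L (x, y) (x', y') \<longleftrightarrow> x = x' + 1 \<and> y' = y"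
| "step R (x, y) (x', y') \<longleftrightarrow> x' = x + 1 \<and> y' = y"
| "step U (x, y) (x', y') \<longleftrightarrow> x' = x \<and> y = y' + 1"
| "step D (x, y) (x', y') \<longleftrightarrow> x' = x \<and> y' = y + 1"

definition grid :: "nat \<Rightarrow> nat \<Rightarrow> (nat \<times> nat) lrud" where
  "grid xm ym = (let V = {0..xm} \<times> {0..ym} in
     \<lparr>univ = V, rel = \<lambda>d. {(v, w). v \<in> V \<and> w \<in> V \<and> step d v w}\<rparr>)"

end

theory Submission
  imports Defs
begin

text \<open>A long strip of bounded height contains, by the pigeonhole principle, two disjoint windows of
  columns with the same unary predicates. Cutting the horizontal edges in the middle of both windows
  and reconnecting them crosswise splits off a cylinder, so the result is not a grid, but it
  preserves the isomorphism type of the neighbourhood of fixed radius of every vertex. By the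
  bijective form of Hanf's locality theorem the sentence cannot tell the two structures apart.
  Full axiomatizability of the grids is the special case of height \<open>0\<close>.\<close>

section \<open>Hanf locality\<close>

text \<open>Only finite models count, so compactness cannot produce the non-grid; it is built
  explicitly. Rewiring leaves every vertex in place, and the identity serves as the bijection in
  Hanf's theorem. The balls of the rewired strip are never described: their shape depends on the
  position relative to the cuts and borders. Each isomorphism of balls is instead the restriction of
  a permutation of entire columns, for which only the disturbed edges must be located. The constants
  come from this. For locality radius \<open>r\<close> a half window has \<open>r + 1\<close>
  columns, so that from one side of a cut the far end of the half on the other side is out of sight.
  Windows start at least \<open>4 * (r + 1)\<close> apart, so that a column just right of one window
  is not close to the other one.\<close>

definition gaifman :: "('a, 'x) lrud_scheme \<Rightarrow> ('a \<times> 'a) set" where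
  "gaifman A = Id \<union> (\<Union>d. rel A d \<union> (rel A d)\<inverse>)"

text \<open>Since \<open>gaifman A\<close> contains \<open>Id\<close>, exactly \<open>r\<close>
  steps reach everything at distance at most \<open>r\<close>, and a pair outside
  \<open>gaifman A\<close> is both distinct and unrelated in either order.\<close>

definition nbhd :: "('a, 'x) lrud_scheme \<Rightarrow> nat \<Rightarrow> 'a set \<Rightarrow> 'a set" where
  "nbhd A r S = (gaifman A ^^ r) `` S"

lemma nbhd_0 [simp]: "nbhd A 0 S = S"
  by (simp add: nbhd_def)

lemma nbhd_Suc: "nbhd A (Suc r) S = gaifman A `` nbhd A r S"
  by (simp add: nbhd_def relcomp_Image)

lemma nbhd_add: "nbhd A (r + s) S = nbhd A s (nbhd A r S)"
  by (simp add: nbhd_def relpow_add relcomp_Image)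

lemma nbhd_mono: "S \<subseteq> T \<Longrightarrow> nbhd A r S \<subseteq> nbhd A r T"
  by (auto simp: nbhd_def)

lemma nbhd_Un: "nbhd A r (S \<union> T) = nbhd A r S \<union> nbhd A r T"
  by (auto simp: nbhd_def)

lemma subset_nbhd: "S \<subseteq> nbhd A r S"
  by (induction r) (auto simp: nbhd_Suc gaifman_def)

lemma nbhd_subset_univ:
  assumes "is_structure P A" "S \<subseteq> univ A"
  shows "nbhd A r S \<subseteq> univ A"
proof (induction r)
  case (Suc r)
  have "gaifman A `` nbhd A r S \<subseteq> univ A"
    using assms(1) Suc unfolding is_structure_def gaifman_def by blast
  then show ?case
    by (simp add: nbhd_Suc)
qed (use assms in simp)

lemma sym_gaifman: "sym (gaifman A)"
  by (auto simp: gaifman_def sym_def)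

lemma sym_relpow:
  assumes "sym E"
  shows "sym (E ^^ n)"
proof (rule symI)
  show "(y, x) \<in> E ^^ n" if "(x, y) \<in> E ^^ n" for x y
    using that
  proof (induction n arbitrary: y)
    case (Suc n)
    then obtain z where "(x, z) \<in> E ^^ n" "(z, y) \<in> E"
      by auto
    then show ?case
      using Suc.IH assms by (meson relpow_Suc_I2 symD)
  qed simp
qed

lemma nbhd_commute: "y \<in> nbhd A r {x} \<longleftrightarrow> x \<in> nbhd A r {y}"
  using sym_relpow[OF sym_gaifman[of A], of r] by (auto simp: nbhd_def sym_def)

text \<open>The edge would complete a path of length \<open>r + 1 + r\<close> from \<open>S\<close>
  to \<open>c\<close>. As \<open>gaifman A\<close> is reflexive, disjointness of the two balls is
  included.\<close>

lemma no_edge_between_nbhds: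
  assumes "c \<notin> nbhd A (2 * r + 1) S" "y \<in> nbhd A r S" "z \<in> nbhd A r {c}"
  shows "(y, z) \<notin> gaifman A"
proof
  assume "(y, z) \<in> gaifman A"
  then have "{z} \<subseteq> nbhd A (Suc r) S"
    using assms(2) by (auto simp: nbhd_Suc)
  then have "c \<in> nbhd A r (nbhd A (Suc r) S)"
    using assms(3) nbhd_mono nbhd_commute by (metis subsetD)
  also have "\<dots> = nbhd A (2 * r + 1) S"
    using nbhd_add[of A "Suc r" r S] by (simp add: mult_2)
  finally show False
    using assms(1) by simp
qed

section \<open>Isomorphisms between balls\<close>

definition embedding_on ::
  "'p set \<Rightarrow> ('a, 'p) lrud_pred \<Rightarrow> ('b, 'p) lrud_pred \<Rightarrow> ('a \<Rightarrow> 'b) \<Rightarrow> 'a set \<Rightarrow> bool" where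
  "embedding_on P A B h T \<longleftrightarrow> inj_on h T \<and>
     (\<forall>a\<in>T. \<forall>p\<in>P. a \<in> pred A p \<longleftrightarrow> h a \<in> pred B p) \<and>
     (\<forall>a\<in>T. \<forall>b\<in>T. \<forall>d. (a, b) \<in> rel A d \<longleftrightarrow> (h a, h b) \<in> rel B d)"

definition nbhd_iso ::
  "'p set \<Rightarrow> nat \<Rightarrow> ('a, 'p) lrud_pred \<Rightarrow> ('b, 'p) lrud_pred \<Rightarrow> ('a \<Rightarrow> 'b) \<Rightarrow> 'a set \<Rightarrow> bool" where
  "nbhd_iso P r A B h S \<longleftrightarrow>
     embedding_on P A B h (nbhd A r S) \<and> h ` nbhd A r S = nbhd B r (h ` S)"

lemma embedding_on_subset: "embedding_on P A B h T \<Longrightarrow> T' \<subseteq> T \<Longrightarrow> embedding_on P A B h T'"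
  unfolding embedding_on_def by (meson inj_on_subset subsetD)

lemma embedding_on_gaifman:
  assumes "embedding_on P A B h T" "a \<in> T" "b \<in> T"
  shows "(a, b) \<in> gaifman A \<longleftrightarrow> (h a, h b) \<in> gaifman B"
  using assms unfolding embedding_on_def gaifman_def by (auto dest: inj_onD)

lemma embedding_on_inv:
  assumes "embedding_on P A B h T"
  shows "embedding_on P B A (inv_into T h) (h ` T)"
  using assms unfolding embedding_on_def by (auto simp: inj_on_inv_into)

lemma embedding_on_comp:
  assumes "embedding_on P A B h T" "embedding_on P B C k (h ` T)"
  shows "embedding_on P A C (k \<circ> h) T"
  using assms unfolding embedding_on_def by (auto intro: comp_inj_on)

text \<open>Balls grow edge by edge. Edges of \<open>A\<close> map forward, but an edge of
  \<open>B\<close> pulls back only if its endpoint lies in the image of \<open>T\<close>; the last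
  hypothesis guarantees this.\<close>

lemma image_nbhd:
  assumes h: "embedding_on P A B h T"
    and "nbhd A s X \<subseteq> T" "nbhd B s (h ` X) \<subseteq> h ` T"
  shows "h ` nbhd A s X = nbhd B s (h ` X)"
  using assms(2,3)
proof (induction s)
  case (Suc s)
  have sub: "nbhd A s X \<subseteq> nbhd A (Suc s) X" "nbhd B s (h ` X) \<subseteq> nbhd B (Suc s) (h ` X)"
    by (auto simp: nbhd_Suc gaifman_def)
  have IH: "h ` nbhd A s X = nbhd B s (h ` X)"
    by (rule Suc.IH) (use sub Suc.prems in auto)
  have "h ` (gaifman A `` nbhd A s X) = gaifman B `` (h ` nbhd A s X)"
  proof (intro equalityI subsetI)
    fix y
    assume "y \<in> h ` (gaifman A `` nbhd A s X)"
    then obtain x z where xz: "y = h x" "z \<in> nbhd A s X" "(z, x) \<in> gaifman A"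
      by auto
    moreover have "x \<in> T" "z \<in> T"
      using xz Suc.prems(1) sub(1) by (auto simp: nbhd_Suc)
    ultimately show "y \<in> gaifman B `` (h ` nbhd A s X)"
      using embedding_on_gaifman[OF h] by auto
  next
    fix y
    assume *: "y \<in> gaifman B `` (h ` nbhd A s X)"
    then have "y \<in> h ` T"
      using Suc.prems(2) IH by (auto simp: nbhd_Suc)
    then obtain x where x: "y = h x" "x \<in> T"
      by auto
    obtain z where z: "z \<in> nbhd A s X" "(h z, y) \<in> gaifman B"
      using * by auto
    then have "(z, x) \<in> gaifman A"
      using embedding_on_gaifman[OF h, of z x] x sub(1) Suc.prems(1) by blast
    then show "y \<in> h ` (gaifman A `` nbhd A s X)"
      using x z by auto
  qed
  then show ?case
    by (simp add: nbhd_Suc IH)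
qed simp

text \<open>One large local isomorphism supplies smaller ones around every part of its inner ball;
  the losses of radius in the game are instances of this.\<close>

lemma nbhd_iso_shrink:
  assumes h: "nbhd_iso P (r + s) A B h S" and X: "X \<subseteq> nbhd A r S"
  shows "nbhd_iso P s A B h X"
proof -
  have emb: "embedding_on P A B h (nbhd A (r + s) S)"
    and im: "h ` nbhd A (r + s) S = nbhd B (r + s) (h ` S)"
    using h by (auto simp: nbhd_iso_def)
  have 1: "nbhd A s X \<subseteq> nbhd A (r + s) S"
    using nbhd_mono[OF X] by (simp add: nbhd_add)
  have "h ` nbhd A r S = nbhd B r (h ` S)"
  proof (rule image_nbhd[OF emb])
    show "nbhd A r S \<subseteq> nbhd A (r + s) S" "nbhd B r (h ` S) \<subseteq> h ` nbhd A (r + s) S"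
      unfolding im by (simp_all add: nbhd_add subset_nbhd)
  qed
  then have "nbhd B s (h ` X) \<subseteq> h ` nbhd A (r + s) S"
    unfolding im using nbhd_mono[of "h ` X" "nbhd B r (h ` S)"] X by (metis image_mono nbhd_add)
  then show ?thesis
    using image_nbhd[OF emb 1] embedding_on_subset[OF emb 1] by (simp add: nbhd_iso_def)
qed

text \<open>The index set \<open>I\<close> is a set of variables for positions of the game, and \<open>{()}\<close> when the
  neighbourhoods of single elements are compared.\<close>

definition locally_iso ::
  "'p set \<Rightarrow> nat \<Rightarrow> ('a, 'p) lrud_pred \<Rightarrow> ('b, 'p) lrud_pred \<Rightarrow>
     'i set \<Rightarrow> ('i \<Rightarrow> 'a) \<Rightarrow> ('i \<Rightarrow> 'b) \<Rightarrow> bool" where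
  "locally_iso P r A B I v w \<longleftrightarrow> (\<exists>h. nbhd_iso P r A B h (v ` I) \<and> (\<forall>i\<in>I. h (v i) = w i))"

lemma locally_iso_shrink:
  assumes "locally_iso P r A B I v w" "s \<le> r" "J \<subseteq> I"
  shows "locally_iso P s A B J v w"
proof -
  obtain h where h: "nbhd_iso P r A B h (v ` I)" "\<forall>i\<in>I. h (v i) = w i"
    using assms(1) by (auto simp: locally_iso_def)
  have "v ` J \<subseteq> nbhd A (r - s) (v ` I)"
    using assms(3) subset_nbhd[of "v ` I" A "r - s"] by auto
  then have "nbhd_iso P s A B h (v ` J)"
    using nbhd_iso_shrink[of P "r - s" s A B h "v ` I"] h(1) assms(2) by simp
  then show ?thesis
    using h(2) assms(3) by (auto simp: locally_iso_def)
qed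

lemma locally_iso_empty: "locally_iso P r A B {} v w"
  by (simp add: locally_iso_def nbhd_iso_def embedding_on_def nbhd_def)

lemma locally_iso_sym:
  assumes "locally_iso P r A B I v w"
  shows "locally_iso P r B A I w v"
proof -
  obtain h where h: "nbhd_iso P r A B h (v ` I)" and hv: "\<forall>i\<in>I. h (v i) = w i"
    using assms by (auto simp: locally_iso_def)
  let ?T = "nbhd A r (v ` I)"
  let ?k = "inv_into ?T h"
  have emb: "embedding_on P A B h ?T" and im: "h ` ?T = nbhd B r (w ` I)"
    using h hv by (auto simp: nbhd_iso_def image_image)
  have inj: "inj_on h ?T"
    using emb by (simp add: embedding_on_def)
  have kw: "\<forall>i\<in>I. ?k (w i) = v i"
    using hv inj subset_nbhd[of "v ` I" A r] by (metis image_subset_iff inv_into_f_f)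
  moreover have "nbhd_iso P r B A ?k (w ` I)"
    unfolding nbhd_iso_def im[symmetric]
  proof
    show "embedding_on P B A ?k (h ` ?T)"
      by (rule embedding_on_inv[OF emb])
    show "?k ` (h ` ?T) = nbhd A r (?k ` w ` I)"
      using inj kw by (simp add: image_image)
  qed
  ultimately show ?thesis
    by (auto simp: locally_iso_def)
qed

lemma locally_iso_trans:
  assumes "locally_iso P r A B I u v" "locally_iso P r B C I v w"
  shows "locally_iso P r A C I u w"
proof -
  obtain h where h: "nbhd_iso P r A B h (u ` I)" and hu: "\<forall>i\<in>I. h (u i) = v i"
    using assms(1) by (auto simp: locally_iso_def)
  obtain k where k: "nbhd_iso P r B C k (v ` I)" and kv: "\<forall>i\<in>I. k (v i) = w i"
    using assms(2) by (auto simp: locally_iso_def)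
  have v: "h ` u ` I = v ` I"
    using hu by (auto simp: image_image)
  have "nbhd_iso P r A C (k \<circ> h) (u ` I)"
    using h k embedding_on_comp[of P A B h "nbhd A r (u ` I)" C k]
    unfolding nbhd_iso_def v image_comp[symmetric] by simp
  then show ?thesis
    using hu kv by (auto simp: locally_iso_def)
qed

abbreviation point_iso ::
  "'p set \<Rightarrow> nat \<Rightarrow> ('a, 'p) lrud_pred \<Rightarrow> ('b, 'p) lrud_pred \<Rightarrow> 'a \<Rightarrow> 'b \<Rightarrow> bool" where
  "point_iso P r A B x y \<equiv> locally_iso P r A B {()} (\<lambda>_. x) (\<lambda>_. y)"

lemma point_isoI: "nbhd_iso P r A B h {x} \<Longrightarrow> point_iso P r A B x (h x)"
  by (auto simp: locally_iso_def)

section \<open>Extending a position by one move\<close>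

lemma bij_betw_Int:
  assumes "bij_betw f X Y" "\<And>x. x \<in> X \<Longrightarrow> f x \<in> Q \<longleftrightarrow> x \<in> C"
  shows "bij_betw f (C \<inter> X) (Q \<inter> Y)"
proof (rule bij_betw_subset[OF assms(1)])
  show "f ` (C \<inter> X) = Q \<inter> Y"
    using assms(2) bij_betw_imp_surj_on[OF assms(1)] by auto
qed simp

text \<open>Duplicator's answer to a move far from the current position exists by counting: the elements
  of the type of \<open>c\<close> near the position are matched by \<open>h\<close>, and all of them are matched by \<open>f\<close>.\<close>

lemma far_answer:
  assumes fin: "finite (univ A)" "finite (univ B)"
    and str: "is_structure P A" "is_structure P B"
    and S: "S \<subseteq> univ A" "h ` S \<subseteq> univ B"
    and h: "nbhd_iso P (3 * r + 1) A B h S"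
    and f: "bij_betw f (univ A) (univ B)" "\<And>x. x \<in> univ A \<Longrightarrow> point_iso P r A B x (f x)"
    and c: "c \<in> univ A" "c \<notin> nbhd A (2 * r + 1) S"
  obtains d where "d \<in> univ B" "d \<notin> nbhd B (2 * r + 1) (h ` S)" "point_iso P r A B c d"
proof -
  let ?N = "nbhd A (2 * r + 1) S" and ?N' = "nbhd B (2 * r + 1) (h ` S)"
  \<comment> \<open>Types in both structures are measured against the single element
    \<open>f c\<close>, so \<open>CA\<close> and \<open>CB\<close> are the same type class taken in
    \<open>A\<close> and in \<open>B\<close>.\<close>
  define CA where "CA = {x \<in> univ A. point_iso P r A B x (f c)}"
  define CB where "CB = {y \<in> univ B. point_iso P r B B y (f c)}"
  have match: "x \<in> CA \<longleftrightarrow> y \<in> CB"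
    if "x \<in> univ A" "y \<in> univ B" "point_iso P r A B x y" for x y
    using that locally_iso_sym[OF that(3)] unfolding CA_def CB_def
    by (auto intro: locally_iso_trans)
  have "nbhd_iso P (r + (2 * r + 1)) A B h S"
    using h by (simp add: algebra_simps)
  then have "nbhd_iso P (2 * r + 1) A B h S"
    by (rule nbhd_iso_shrink) (rule subset_nbhd)
  then have hN: "bij_betw h ?N ?N'"
    by (auto simp: nbhd_iso_def embedding_on_def bij_betw_def)
  have NA: "?N \<subseteq> univ A" and NB: "?N' \<subseteq> univ B"
    using nbhd_subset_univ str S by blast+
  have h_point: "point_iso P r A B x (h x)" if "x \<in> ?N" for x
  proof (rule point_isoI)
    \<comment> \<open>The \<open>r\<close>-ball of a point of \<open>?N\<close> stays inside the
      domain of \<open>h\<close>, so \<open>h\<close> preserves the types of all points of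
      \<open>?N\<close>.\<close>
    have "nbhd_iso P ((2 * r + 1) + r) A B h S"
      using h by (simp add: algebra_simps)
    then show "nbhd_iso P r A B h {x}"
      by (rule nbhd_iso_shrink) (use that in simp)
  qed
  have fC: "f x \<in> CB \<longleftrightarrow> x \<in> CA" if "x \<in> univ A" for x
    using match[OF that _ f(2)[OF that]] bij_betwE[OF f(1)] that by blast
  have hC: "h x \<in> CB \<longleftrightarrow> x \<in> CA" if "x \<in> ?N" for x
    using match[OF _ _ h_point[OF that]] bij_betwE[OF hN] that NA NB by blast
  have "CA \<inter> univ A = CA" "CB \<inter> univ B = CB"
    by (auto simp: CA_def CB_def)
  then have card: "card CA = card CB"
    using bij_betw_same_card[OF bij_betw_Int[OF f(1) fC]] by simp
  have cardN: "card (CA \<inter> ?N) = card (CB \<inter> ?N')"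
    by (rule bij_betw_same_card[OF bij_betw_Int[OF hN hC]])
  have finC: "finite CA" "finite CB"
    using fin by (auto simp: CA_def CB_def)
  have "c \<in> CA - ?N"
    using c f(2)[OF c(1)] by (simp add: CA_def)
  then have "card (CA - ?N) > 0"
    using finC(1) by (auto simp: card_gt_0_iff)
  then have "card (CB - ?N') > 0"
    using card cardN finC by (simp add: card_Diff_subset_Int)
  then obtain d where d: "d \<in> CB" "d \<notin> ?N'"
    by (auto simp: card_gt_0_iff)
  then have "point_iso P r B B (f c) d"
    using locally_iso_sym[of P r B B "{()}"] by (simp add: CB_def)
  then have "point_iso P r A B c d"
    using f(2)[OF c(1)] locally_iso_trans by blast
  then show thesis
    using that d by (auto simp: CB_def)
qed

text \<open>The two balls are disjoint and no relation joins them, in \<open>A\<close> and likewise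
  for their images in \<open>B\<close>, so there is nothing to check between the pieces, and the
  \<open>if\<close> cannot misplace a point of the ball of \<open>c\<close>.\<close>

lemma nbhd_iso_glue:
  assumes h: "nbhd_iso P r A B h S" and k: "nbhd_iso P r A B k {c}"
    and c: "c \<notin> nbhd A (2 * r + 1) S" and kc: "k c \<notin> nbhd B (2 * r + 1) (h ` S)"
  shows "nbhd_iso P r A B (\<lambda>x. if x \<in> nbhd A r S then h x else k x) (insert c S)"
proof -
  define g where "g = (\<lambda>x. if x \<in> nbhd A r S then h x else k x)"
  let ?X = "nbhd A r S" and ?Y = "nbhd A r {c}"
  note sepA = no_edge_between_nbhds[OF c]
  note sepB = no_edge_between_nbhds[OF kc]
  have disj: "?X \<inter> ?Y = {}"
    using sepA by (force simp: gaifman_def)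
  have hX: "h ` ?X = nbhd B r (h ` S)" and kY: "k ` ?Y = nbhd B r {k c}"
    using h k by (auto simp: nbhd_iso_def)
  have gX: "g x = h x" if "x \<in> ?X" for x
    using that by (simp add: g_def)
  have gY: "g x = k x" if "x \<in> ?Y" for x
    using that disj by (auto simp: g_def)
  have U: "nbhd A r (insert c S) = ?X \<union> ?Y"
    using nbhd_Un[of A r S "{c}"] by simp
  have XY: "(h x, k y) \<notin> gaifman B" if "x \<in> ?X" "y \<in> ?Y" for x y
    using sepB that hX kY by (metis imageI)
  have cross: "h x \<noteq> k y" "(x, y) \<notin> rel A d" "(y, x) \<notin> rel A d"
    "(h x, k y) \<notin> rel B d" "(k y, h x) \<notin> rel B d" if "x \<in> ?X" "y \<in> ?Y" for x y d
    using XY[OF that] sepA[OF that] by (auto simp: gaifman_def)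
  have eX: "embedding_on P A B h ?X" and eY: "embedding_on P A B k ?Y"
    using h k by (auto simp: nbhd_iso_def)
  have "embedding_on P A B g (?X \<union> ?Y)"
    unfolding embedding_on_def
  proof (intro conjI ballI allI)
    show "inj_on g (?X \<union> ?Y)"
    proof (rule inj_onI)
      fix x y
      assume "x \<in> ?X \<union> ?Y" "y \<in> ?X \<union> ?Y" "g x = g y"
      then show "x = y"
        using eX eY gX gY cross(1) unfolding embedding_on_def inj_on_def
        by (metis Un_iff)
    qed
  next
    fix a p
    assume "a \<in> ?X \<union> ?Y" "p \<in> P"
    then show "a \<in> pred A p \<longleftrightarrow> g a \<in> pred B p"
      using eX eY gX gY unfolding embedding_on_def by (metis Un_iff)
  next
    fix a b d
    assume ab: "a \<in> ?X \<union> ?Y" "b \<in> ?X \<union> ?Y"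
    then consider "a \<in> ?X" "b \<in> ?X" | "a \<in> ?X" "b \<in> ?Y" | "a \<in> ?Y" "b \<in> ?X" | "a \<in> ?Y" "b \<in> ?Y"
      by blast
    then show "(a, b) \<in> rel A d \<longleftrightarrow> (g a, g b) \<in> rel B d"
    proof cases
      case 1 then show ?thesis using eX gX by (simp add: embedding_on_def)
    next
      case 2 then show ?thesis by (simp add: cross gX gY)
    next
      case 3 then show ?thesis by (simp add: cross gX gY)
    next
      case 4 then show ?thesis using eY gY by (simp add: embedding_on_def)
    qed
  qed
  moreover have "g ` (?X \<union> ?Y) = nbhd B r (g ` insert c S)"
  proof -
    have "g ` S = h ` S" "g c = k c"
      using gX gY subset_nbhd[of S A r] subset_nbhd[of "{c}" A r] by (force, blast)
    then have "nbhd B r (g ` insert c S) = nbhd B r (h ` S) \<union> nbhd B r {k c}"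
      using nbhd_Un[of B r "h ` S" "{k c}"] by simp
    moreover have "g ` ?X = h ` ?X" "g ` ?Y = k ` ?Y"
      using gX gY by (auto cong: image_cong_simp)
    ultimately show ?thesis
      by (simp add: image_Un hX kY)
  qed
  ultimately show ?thesis
    by (simp add: nbhd_iso_def U flip: g_def)
qed

text \<open>If \<open>c\<close> is within \<open>2 * r + 1\<close> of the position, its
  \<open>r\<close>-ball lies in the domain of the given isomorphism, which itself answers; this
  costs \<open>(2 * r + 1) + r = 3 * r + 1\<close>. Otherwise an answer found by counting is glued
  on, for which the gap \<open>2 * r + 1\<close> is large enough.\<close>

lemma locally_iso_extend:
  assumes fin: "finite (univ A)" "finite (univ B)"
    and str: "is_structure P A" "is_structure P B"
    and vw: "v ` I \<subseteq> univ A" "w ` I \<subseteq> univ B" "locally_iso P (3 * r + 1) A B I v w"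
    and f: "bij_betw f (univ A) (univ B)" "\<And>x. x \<in> univ A \<Longrightarrow> point_iso P r A B x (f x)"
    and c: "c \<in> univ A" and i: "i \<notin> I"
  obtains d where "d \<in> univ B" "locally_iso P r A B (insert i I) (v(i := c)) (w(i := d))"
proof -
  obtain h where h: "nbhd_iso P (3 * r + 1) A B h (v ` I)" and hv: "\<forall>j\<in>I. h (v j) = w j"
    using vw(3) by (auto simp: locally_iso_def)
  have S: "h ` v ` I = w ` I"
    using hv by (auto simp: image_image)
  have V: "(v(i := c)) ` insert i I = insert c (v ` I)"
    using i by auto
  have "\<exists>g. nbhd_iso P r A B g (insert c (v ` I)) \<and> (\<forall>j\<in>I. g (v j) = w j) \<and> g c \<in> univ B"
  proof (cases "c \<in> nbhd A (2 * r + 1) (v ` I)")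
    case True
    have h': "nbhd_iso P ((2 * r + 1) + r) A B h (v ` I)"
      using h by (simp add: algebra_simps)
    have "insert c (v ` I) \<subseteq> nbhd A (2 * r + 1) (v ` I)"
      using True subset_nbhd by (metis insert_subset)
    then have g: "nbhd_iso P r A B h (insert c (v ` I))"
      by (rule nbhd_iso_shrink[OF h'])
    have "h c \<in> h ` nbhd A (3 * r + 1) (v ` I)"
      using True nbhd_add[of A "2 * r + 1" r "v ` I"]
        subset_nbhd[of "nbhd A (2 * r + 1) (v ` I)" A r]
      by (intro imageI) (auto simp: algebra_simps)
    also have "\<dots> \<subseteq> univ B"
      using h nbhd_subset_univ[OF str(2) vw(2)] by (simp add: nbhd_iso_def S)
    finally show ?thesis
      using g hv by blast
  next
    case False
    obtain d where d: "d \<in> univ B" "d \<notin> nbhd B (2 * r + 1) (h ` v ` I)" "point_iso P r A B c d"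
      using far_answer[OF fin str vw(1) _ h f c False] vw(2) S by metis
    then obtain k where k: "nbhd_iso P r A B k {c}" "k c = d"
      by (auto simp: locally_iso_def)
    have "nbhd_iso P ((2 * r + 1) + r) A B h (v ` I)"
      using h by (simp add: algebra_simps)
    then have h': "nbhd_iso P r A B h (v ` I)"
      by (rule nbhd_iso_shrink) (rule subset_nbhd)
    let ?g = "\<lambda>x. if x \<in> nbhd A r (v ` I) then h x else k x"
    have "nbhd_iso P r A B ?g (insert c (v ` I))"
      using nbhd_iso_glue[OF h' k(1) False] d(2) k(2) by simp
    moreover have "\<forall>j\<in>I. ?g (v j) = w j"
      using hv subset_nbhd[of "v ` I" A r] by auto
    \<comment> \<open>The separation lemma is applied to the reflexive pair \<open>(c, c)\<close>;
      hence \<open>?g\<close> takes its second branch at \<open>c\<close>.\<close>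
    moreover have "c \<notin> nbhd A r (v ` I)"
      using no_edge_between_nbhds[OF False, of c c] subset_nbhd[of "{c}" A r]
      by (auto simp: gaifman_def)
    then have "?g c \<in> univ B"
      using d(1) k(2) by simp
    ultimately show ?thesis
      by blast
  qed
  then obtain g where g: "nbhd_iso P r A B g (insert c (v ` I))" "\<forall>j\<in>I. g (v j) = w j" "g c \<in> univ B"
    by blast
  then have "locally_iso P r A B (insert i I) (v(i := c)) (w(i := g c))"
    unfolding locally_iso_def V using i by (intro exI[of _ g]) auto
  then show thesis
    using that g(3) by blast
qed

section \<open>Transfer of truth\<close>

text \<open>The recurrence inverts the loss of one move: to keep radius \<open>r\<close> after a
  quantifier is answered, a position must start with \<open>3 * r + 1\<close>.\<close>

primrec radius :: "'p fm \<Rightarrow> nat" where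
  "radius (Eq i j) = 0"
| "radius (Rel d i j) = 0"
| "radius (Pred p i) = 0"
| "radius (Neg \<phi>) = radius \<phi>"
| "radius (Conj \<phi> \<psi>) = max (radius \<phi>) (radius \<psi>)"
| "radius (Disj \<phi> \<psi>) = max (radius \<phi>) (radius \<psi>)"
| "radius (Exists i \<phi>) = 3 * radius \<phi> + 1"
| "radius (Forall i \<phi>) = 3 * radius \<phi> + 1"

text \<open>A quantifier forgets the old value of \<open>i\<close>, hence the index set
  \<open>fv \<phi> - {i}\<close>; if \<open>i\<close> is not free in \<open>\<phi>\<close>, the new
  value is discarded by shrinking.\<close>

lemma locally_iso_extend_fv:
  assumes fin: "finite (univ A)" "finite (univ B)"
    and str: "is_structure P A" "is_structure P B"
    and v: "v ` (fv \<phi> - {i}) \<subseteq> univ A" and w: "w ` (fv \<phi> - {i}) \<subseteq> univ B"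
    and vw: "locally_iso P (3 * r + 1) A B (fv \<phi> - {i}) v w"
    and f: "bij_betw f (univ A) (univ B)" "\<And>x. x \<in> univ A \<Longrightarrow> point_iso P r' A B x (f x)"
    and r': "r \<le> r'" and c: "c \<in> univ A"
  shows "\<exists>d\<in>univ B. locally_iso P r A B (fv \<phi>) (v(i := c)) (w(i := d)) \<and>
    (v(i := c)) ` fv \<phi> \<subseteq> univ A \<and> (w(i := d)) ` fv \<phi> \<subseteq> univ B"
proof -
  have f': "point_iso P r A B x (f x)" if "x \<in> univ A" for x
    using locally_iso_shrink[OF f(2)[OF that] r'] by simp
  obtain d where d: "d \<in> univ B"
    "locally_iso P r A B (insert i (fv \<phi> - {i})) (v(i := c)) (w(i := d))"
    using locally_iso_extend[OF fin str v w vw f(1) f' c] by blast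
  have "locally_iso P r A B (fv \<phi>) (v(i := c)) (w(i := d))"
    by (rule locally_iso_shrink[OF d(2)]) auto
  then show ?thesis
    using d(1) c v w by (intro bexI[of _ d]) auto
qed

text \<open>A back-and-forth induction. One bijection at the fixed radius \<open>r\<close> serves
  every subformula, since the radii needed are at most \<open>r\<close>; moves in \<open>B\<close>
  are answered with its inverse.\<close>

lemma sat_locally_iso:
  fixes A :: "('a, 'p) lrud_pred" and B :: "('b, 'p) lrud_pred"
  assumes fin: "finite (univ A)" "finite (univ B)"
    and str: "is_structure P A" "is_structure P B"
    and f: "bij_betw f (univ A) (univ B)" "\<And>x. x \<in> univ A \<Longrightarrow> point_iso P r A B x (f x)"
    and "set_fm \<phi> \<subseteq> P" "radius \<phi> \<le> r"
    and "v ` fv \<phi> \<subseteq> univ A" "w ` fv \<phi> \<subseteq> univ B" "locally_iso P (radius \<phi>) A B (fv \<phi>) v w"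
  shows "sat A v \<phi> \<longleftrightarrow> sat B w \<phi>"
proof -
  have f': "bij_betw (inv_into (univ A) f) (univ B) (univ A)"
    by (rule bij_betw_inv_into[OF f(1)])
  have f'2: "point_iso P r B A y (inv_into (univ A) f y)" if "y \<in> univ B" for y
  proof -
    have "f (inv_into (univ A) f y) = y" "inv_into (univ A) f y \<in> univ A"
      using that f(1) bij_betwE[OF f'] by (auto simp: bij_betw_inv_into_right)
    then show ?thesis
      using f(2) locally_iso_sym by metis
  qed
  have forward: "\<exists>d\<in>univ B. sat A (v(i := c)) \<psi> \<longleftrightarrow> sat B (w(i := d)) \<psi>"
    if IH: "\<And>v w. v ` fv \<psi> \<subseteq> univ A \<Longrightarrow> w ` fv \<psi> \<subseteq> univ B \<Longrightarrow>
          locally_iso P (radius \<psi>) A B (fv \<psi>) v w \<Longrightarrow> sat A v \<psi> \<longleftrightarrow> sat B w \<psi>"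
      and H: "3 * radius \<psi> + 1 \<le> r" "v ` (fv \<psi> - {i}) \<subseteq> univ A" "w ` (fv \<psi> - {i}) \<subseteq> univ B"
        "locally_iso P (3 * radius \<psi> + 1) A B (fv \<psi> - {i}) v w" "c \<in> univ A" for \<psi> v w i c
  proof -
    have "radius \<psi> \<le> r"
      using H(1) by simp
    then obtain d where d: "d \<in> univ B"
      "locally_iso P (radius \<psi>) A B (fv \<psi>) (v(i := c)) (w(i := d))"
      "(v(i := c)) ` fv \<psi> \<subseteq> univ A" "(w(i := d)) ` fv \<psi> \<subseteq> univ B"
      using locally_iso_extend_fv[OF fin str H(2,3,4) f _ H(5)] by blast
    show ?thesis
      using IH[OF d(3,4,2)] d(1) by blast
  qed
  have backward: "\<exists>c\<in>univ A. sat A (v(i := c)) \<psi> \<longleftrightarrow> sat B (w(i := d)) \<psi>"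
    if IH: "\<And>v w. v ` fv \<psi> \<subseteq> univ A \<Longrightarrow> w ` fv \<psi> \<subseteq> univ B \<Longrightarrow>
          locally_iso P (radius \<psi>) A B (fv \<psi>) v w \<Longrightarrow> sat A v \<psi> \<longleftrightarrow> sat B w \<psi>"
      and H: "3 * radius \<psi> + 1 \<le> r" "v ` (fv \<psi> - {i}) \<subseteq> univ A" "w ` (fv \<psi> - {i}) \<subseteq> univ B"
        "locally_iso P (3 * radius \<psi> + 1) A B (fv \<psi> - {i}) v w" "d \<in> univ B" for \<psi> v w i d
  proof -
    have "radius \<psi> \<le> r"
      using H(1) by simp
    then obtain c where c: "c \<in> univ A"
      "locally_iso P (radius \<psi>) B A (fv \<psi>) (w(i := d)) (v(i := c))"
      "(w(i := d)) ` fv \<psi> \<subseteq> univ B" "(v(i := c)) ` fv \<psi> \<subseteq> univ A"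
      using locally_iso_extend_fv[OF fin(2,1) str(2,1) H(3,2) locally_iso_sym[OF H(4)]
          f' f'2 _ H(5)] by blast
    show ?thesis
      using IH[OF c(4,3) locally_iso_sym[OF c(2)]] c(1) by blast
  qed
  show ?thesis
    using assms(7-11)
  proof (induction \<phi> arbitrary: v w)
    case (Eq i j)
    then obtain h where "inj_on h (v ` {i, j})" "h (v i) = w i" "h (v j) = w j"
      by (auto simp: locally_iso_def nbhd_iso_def embedding_on_def)
    then show ?case
      by (auto dest: inj_onD)
  next
    case (Rel d i j)
    then show ?case
      by (auto simp: locally_iso_def nbhd_iso_def embedding_on_def)
  next
    case (Pred p i)
    then show ?case
      by (auto simp: locally_iso_def nbhd_iso_def embedding_on_def)
  next
    case (Neg \<phi>)
    then show ?case
      by simp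
  next
    case (Conj \<phi> \<psi>)
    have "locally_iso P (radius \<phi>) A B (fv \<phi>) v w" "locally_iso P (radius \<psi>) A B (fv \<psi>) v w"
      using locally_iso_shrink[OF Conj.prems(5)] by auto
    then have "sat A v \<phi> \<longleftrightarrow> sat B w \<phi>" "sat A v \<psi> \<longleftrightarrow> sat B w \<psi>"
      using Conj by (auto simp: image_Un)
    then show ?case
      by simp
  next
    case (Disj \<phi> \<psi>)
    have "locally_iso P (radius \<phi>) A B (fv \<phi>) v w" "locally_iso P (radius \<psi>) A B (fv \<psi>) v w"
      using locally_iso_shrink[OF Disj.prems(5)] by auto
    then have "sat A v \<phi> \<longleftrightarrow> sat B w \<phi>" "sat A v \<psi> \<longleftrightarrow> sat B w \<psi>"
      using Disj by (auto simp: image_Un)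
    then show ?case
      by simp
  next
    case (Exists i \<psi>)
    have IH: "sat A v \<psi> \<longleftrightarrow> sat B w \<psi>" if "v ` fv \<psi> \<subseteq> univ A" "w ` fv \<psi> \<subseteq> univ B"
          "locally_iso P (radius \<psi>) A B (fv \<psi>) v w" for v w
      using Exists.IH that Exists.prems(1,2) by simp
    have prems: "3 * radius \<psi> + 1 \<le> r" "v ` (fv \<psi> - {i}) \<subseteq> univ A" "w ` (fv \<psi> - {i}) \<subseteq> univ B"
      "locally_iso P (3 * radius \<psi> + 1) A B (fv \<psi> - {i}) v w"
      using Exists.prems by simp_all
    have "\<forall>c\<in>univ A. \<exists>d\<in>univ B. sat A (v(i := c)) \<psi> \<longleftrightarrow> sat B (w(i := d)) \<psi>"
      using forward[OF IH prems] by blast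
    moreover have "\<forall>d\<in>univ B. \<exists>c\<in>univ A. sat A (v(i := c)) \<psi> \<longleftrightarrow> sat B (w(i := d)) \<psi>"
      using backward[OF IH prems] by blast
    ultimately show ?case
      unfolding sat.simps by blast
  next
    case (Forall i \<psi>)
    have IH: "sat A v \<psi> \<longleftrightarrow> sat B w \<psi>" if "v ` fv \<psi> \<subseteq> univ A" "w ` fv \<psi> \<subseteq> univ B"
          "locally_iso P (radius \<psi>) A B (fv \<psi>) v w" for v w
      using Forall.IH that Forall.prems(1,2) by simp
    have prems: "3 * radius \<psi> + 1 \<le> r" "v ` (fv \<psi> - {i}) \<subseteq> univ A" "w ` (fv \<psi> - {i}) \<subseteq> univ B"
      "locally_iso P (3 * radius \<psi> + 1) A B (fv \<psi> - {i}) v w"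
      using Forall.prems by simp_all
    have "\<forall>c\<in>univ A. \<exists>d\<in>univ B. sat A (v(i := c)) \<psi> \<longleftrightarrow> sat B (w(i := d)) \<psi>"
      using forward[OF IH prems] by blast
    moreover have "\<forall>d\<in>univ B. \<exists>c\<in>univ A. sat A (v(i := c)) \<psi> \<longleftrightarrow> sat B (w(i := d)) \<psi>"
      using backward[OF IH prems] by blast
    ultimately show ?case
      unfolding sat.simps by blast
  qed
qed

text \<open>The game starts at the empty position, which is trivially a local isomorphism. Leaving
  \<open>w\<close> arbitrary covers all assignments quantified over in
  \<open>finite_model\<close>.\<close>

theorem hanf:
  assumes A: "finite_model P \<phi> A" and \<phi>: "sentence P \<phi>"
    and B: "is_structure P B" "finite (univ B)"
    and f: "bij_betw f (univ A) (univ B)"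
      "\<And>x. x \<in> univ A \<Longrightarrow> point_iso P (radius \<phi>) A B x (f x)"
  shows "finite_model P \<phi> B"
proof -
  have "univ A \<noteq> {}"
    using A by (simp add: finite_model_def is_structure_def)
  then obtain a where a: "a \<in> univ A"
    by blast
  then have "sat A (\<lambda>_. a) \<phi>"
    using A by (auto simp: finite_model_def)
  moreover have "sat A (\<lambda>_. a) \<phi> \<longleftrightarrow> sat B w \<phi>" for w
  proof (rule sat_locally_iso[OF _ B(2) _ B(1) f])
    show "finite (univ A)" "is_structure P A" "set_fm \<phi> \<subseteq> P"
      using A \<phi> by (auto simp: finite_model_def sentence_def)
    show "(\<lambda>_. a) ` fv \<phi> \<subseteq> univ A" "w ` fv \<phi> \<subseteq> univ B"
      "locally_iso P (radius \<phi>) A B (fv \<phi>) (\<lambda>_. a) w"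
      using \<phi> by (simp_all add: sentence_def locally_iso_empty)
  qed simp_all
  ultimately show ?thesis
    using B by (simp add: finite_model_def)
qed

text \<open>A bijection of the full universes makes the balls of \<open>B\<close> come for free.
  Edges with just one end in the ball must be respected too: otherwise a point of the ball could
  gain a neighbour in \<open>B\<close>.\<close>

lemma point_iso_global:
  assumes str: "is_structure P A" "is_structure P B"
    and h: "bij_betw h (univ A) (univ B)" and c: "c \<in> univ A"
    and pred: "\<And>a p. a \<in> univ A \<Longrightarrow> p \<in> P \<Longrightarrow> a \<in> pred A p \<longleftrightarrow> h a \<in> pred B p"
    and rel: "\<And>a b d. a \<in> univ A \<Longrightarrow> b \<in> univ A \<Longrightarrow> a \<in> nbhd A r {c} \<or> b \<in> nbhd A r {c} \<Longrightarrow>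
      (a, b) \<in> rel A d \<longleftrightarrow> (h a, h b) \<in> rel B d"
  shows "point_iso P r A B c (h c)"
proof (rule point_isoI)
  have sub: "nbhd A k {c} \<subseteq> univ A" for k
    using nbhd_subset_univ[OF str(1)] c by blast
  have inj: "inj_on h (univ A)"
    using h by (rule bij_betw_imp_inj_on)
  have "embedding_on P A B h (nbhd A r {c})"
    unfolding embedding_on_def using sub[of r] pred rel inj_on_subset[OF inj] by blast
  moreover have "k \<le> r \<Longrightarrow> h ` nbhd A k {c} = nbhd B k {h c}" for k
  proof (induction k)
    case (Suc k)
    have mem: "a \<in> nbhd A r {c}" if "a \<in> nbhd A k {c}" for a
      using that Suc.prems nbhd_add[of A k "r - k" "{c}"]
        subset_nbhd[of "nbhd A k {c}" A "r - k"] by auto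
    have gaif: "(a, b) \<in> gaifman A \<longleftrightarrow> (h a, h b) \<in> gaifman B"
      if "a \<in> nbhd A k {c}" "b \<in> univ A" for a b
    proof -
      have "a \<in> univ A"
        using that(1) sub by blast
      then show ?thesis
        using rel[of a b] rel[of b a] mem[OF that(1)] that(2) inj
        by (auto simp: gaifman_def dest: inj_onD)
    qed
    have "h ` (gaifman A `` nbhd A k {c}) = gaifman B `` (h ` nbhd A k {c})"
    proof (intro equalityI subsetI)
      fix y
      assume "y \<in> h ` (gaifman A `` nbhd A k {c})"
      then obtain a b where ab: "a \<in> nbhd A k {c}" "(a, b) \<in> gaifman A" "y = h b"
        by blast
      then have "b \<in> univ A"
        using sub[of "Suc k"] by (auto simp: nbhd_Suc)
      then show "y \<in> gaifman B `` (h ` nbhd A k {c})"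
        using ab gaif by blast
    next
      fix y
      assume "y \<in> gaifman B `` (h ` nbhd A k {c})"
      then obtain a where a: "a \<in> nbhd A k {c}" "(h a, y) \<in> gaifman B"
        by blast
      have "h a \<in> univ B"
        using a(1) sub bij_betwE[OF h] by blast
      then have "gaifman B `` {h a} \<subseteq> univ B"
        using nbhd_subset_univ[OF str(2), of "{h a}" "Suc 0"] by (simp add: nbhd_Suc)
      then have "y \<in> univ B"
        using a(2) by blast
      then obtain b where "b \<in> univ A" "y = h b"
        using bij_betw_imp_surj_on[OF h] by blast
      then show "y \<in> h ` (gaifman A `` nbhd A k {c})"
        using a gaif by blast
    qed
    then show ?case
      using Suc by (simp add: nbhd_Suc)
  qed simp
  ultimately show "nbhd_iso P r A B h {c}"
    by (simp add: nbhd_iso_def)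
qed

section \<open>Transporting finite models\<close>

lemma restriction_sel [simp]: "univ (restriction M) = univ M" "rel (restriction M) = rel M"
  by (simp_all add: restriction_def)

lemma isomorphic_trans: "isomorphic A B \<Longrightarrow> isomorphic B C \<Longrightarrow> isomorphic A C"
proof -
  assume "isomorphic A B" "isomorphic B C"
  then obtain f g where f: "bij_betw f (univ A) (univ B)"
      "\<And>d a b. a \<in> univ A \<Longrightarrow> b \<in> univ A \<Longrightarrow> (a, b) \<in> rel A d \<longleftrightarrow> (f a, f b) \<in> rel B d"
    and g: "bij_betw g (univ B) (univ C)"
      "\<And>d a b. a \<in> univ B \<Longrightarrow> b \<in> univ B \<Longrightarrow> (a, b) \<in> rel B d \<longleftrightarrow> (g a, g b) \<in> rel C d"
    unfolding isomorphic_def by blast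
  show "isomorphic A C"
    unfolding isomorphic_def
    using bij_betw_trans[OF f(1) g(1)] f(2) g(2) bij_betwE[OF f(1)]
    by (intro exI[of _ "g \<circ> f"]) simp
qed

text \<open>An isomorphism is a local isomorphism at every radius, so invariance of truth is a case
  of Hanf's theorem. It allows work in the coordinates \<open>nat \<times> nat\<close> and a return
  to the given type of models.\<close>

lemma finite_model_transport:
  fixes A :: "('a, 'p) lrud_pred" and B :: "'b lrud"
  assumes A: "finite_model P \<phi> A" and \<phi>: "sentence P \<phi>"
    and iso: "isomorphic (restriction A) B" and B: "\<And>d. rel B d \<subseteq> univ B \<times> univ B"
  obtains M :: "('b, 'p) lrud_pred" where "finite_model P \<phi> M" "restriction M = B"
proof -
  obtain f where f: "bij_betw f (univ A) (univ B)"
    "\<And>d a b. a \<in> univ A \<Longrightarrow> b \<in> univ A \<Longrightarrow> (a, b) \<in> rel A d \<longleftrightarrow> (f a, f b) \<in> rel B d"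
    using iso unfolding isomorphic_def by auto
  define M :: "('b, 'p) lrud_pred" where
    "M = \<lparr>univ = univ B, rel = rel B, pred = \<lambda>p. f ` pred A p\<rparr>"
  have strA: "is_structure P A" and finA: "finite (univ A)"
    using A by (auto simp: finite_model_def)
  have strM: "is_structure P M"
    unfolding is_structure_def
  proof (intro conjI allI ballI)
    show "univ M \<noteq> {}"
      using strA bij_betw_imp_surj_on[OF f(1)] by (auto simp: is_structure_def M_def)
    show "rel M d \<subseteq> univ M \<times> univ M" for d
      using B by (simp add: M_def)
    show "pred M p \<subseteq> univ M" if "p \<in> P" for p
    proof -
      have "f ` pred A p \<subseteq> f ` univ A"
        using strA that by (intro image_mono) (simp add: is_structure_def)
      then show ?thesis
        by (simp add: M_def bij_betw_imp_surj_on[OF f(1)])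
    qed
  qed
  have "finite_model P \<phi> M"
  proof (rule hanf[OF A \<phi> strM])
    show "finite (univ M)"
      using finA bij_betw_finite[OF f(1)] by (simp add: M_def)
    show bij: "bij_betw f (univ A) (univ M)"
      using f(1) by (simp add: M_def)
    have "a \<in> pred A p \<longleftrightarrow> f a \<in> pred M p" if "a \<in> univ A" "p \<in> P" for a p
    proof -
      have "pred A p \<subseteq> univ A"
        using strA that by (auto simp: is_structure_def)
      then show ?thesis
        using that inj_on_image_mem_iff[OF bij_betw_imp_inj_on[OF f(1)]] by (simp add: M_def)
    qed
    then show "point_iso P (radius \<phi>) A M x (f x)" if "x \<in> univ A" for x
      using f(2) by (intro point_iso_global[OF strA strM bij that]) (simp_all add: M_def)
  qed
  moreover have "restriction M = B"
    by (simp add: restriction_def M_def)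
  ultimately show thesis
    using that by blast
qed

lemma isomorphic_copy:
  fixes A :: "'b lrud"
  assumes "infinite (UNIV :: 'a set)" "finite (univ A)"
    and rel: "\<And>d. rel A d \<subseteq> univ A \<times> univ A"
  obtains B :: "'a lrud" where "isomorphic A B" "\<And>d. rel B d \<subseteq> univ B \<times> univ B"
proof -
  obtain S :: "'a set" where "finite S" "card S = card (univ A)"
    using infinite_arbitrarily_large[OF assms(1)] by blast
  then obtain f where f: "bij_betw f (univ A) S"
    using finite_same_card_bij[OF assms(2)] by metis
  define B where "B = \<lparr>univ = S, rel = \<lambda>d. map_prod f f ` rel A d\<rparr>"
  have "rel B d \<subseteq> univ B \<times> univ B" for d
    using rel[of d] bij_betw_imp_surj_on[OF f] by (auto simp: B_def)
  moreover have "(a, b) \<in> rel A d \<longleftrightarrow> (f a, f b) \<in> rel B d" if "a \<in> univ A" "b \<in> univ A" for a b d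
  proof -
    have inj: "inj_on (map_prod f f) (univ A \<times> univ A)"
      using bij_betw_imp_inj_on[OF f] by (intro map_prod_inj_on)
    show ?thesis
      using inj_on_image_mem_iff[OF inj _ rel[of d], of "(a, b)"] that by (simp add: B_def)
  qed
  then have "isomorphic A B"
    unfolding isomorphic_def using f by (auto simp: B_def)
  ultimately show thesis
    using that by blast
qed

section \<open>Rewiring a strip\<close>

text \<open>If \<open>t\<close> swaps \<open>p < q\<close>, the edges leaving columns \<open>p\<close> and \<open>q\<close> are reconnected crosswise, which
  closes columns \<open>p + 1, \<dots>, q\<close> to a cylinder.\<close>

fun rewired_step :: "(nat \<Rightarrow> nat) \<Rightarrow> dir \<Rightarrow> nat \<times> nat \<Rightarrow> nat \<times> nat \<Rightarrow> bool" where
  "rewired_step t L (x, y) (x', y') \<longleftrightarrow> x = Suc (t x') \<and> y' = y"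
| "rewired_step t R (x, y) (x', y') \<longleftrightarrow> x' = Suc (t x) \<and> y' = y"
| "rewired_step t U (x, y) (x', y') \<longleftrightarrow> x' = x \<and> y = y' + 1"
| "rewired_step t D (x, y) (x', y') \<longleftrightarrow> x' = x \<and> y' = y + 1"

definition rewired :: "(nat \<Rightarrow> nat) \<Rightarrow> nat \<Rightarrow> nat \<Rightarrow> (nat \<times> nat) lrud" where
  "rewired t xm ym = (let V = {0..xm} \<times> {0..ym} in
     \<lparr>univ = V, rel = \<lambda>d. {(v, w). v \<in> V \<and> w \<in> V \<and> rewired_step t d v w}\<rparr>)"

lemma univ_grid: "univ (grid xm ym) = {0..xm} \<times> {0..ym}"
  by (simp add: grid_def Let_def)

lemma rel_grid: "(v, w) \<in> rel (grid xm ym) d \<longleftrightarrow>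
    v \<in> {0..xm} \<times> {0..ym} \<and> w \<in> {0..xm} \<times> {0..ym} \<and> step d v w"
  by (simp add: grid_def Let_def)

lemma univ_rewired: "univ (rewired t xm ym) = {0..xm} \<times> {0..ym}"
  by (simp add: rewired_def Let_def)

lemma rel_rewired: "(v, w) \<in> rel (rewired t xm ym) d \<longleftrightarrow>
    v \<in> {0..xm} \<times> {0..ym} \<and> w \<in> {0..xm} \<times> {0..ym} \<and> rewired_step t d v w"
  by (simp add: rewired_def Let_def)

lemma nbhd_strip:
  assumes "\<And>d. rel A d = rel (grid xm ym) d" "(z, y) \<in> nbhd A r {(x, y')}"
  shows "z \<le> x + r \<and> x \<le> z + r"
  using assms(2)
proof (induction r arbitrary: z y)
  case (Suc r)
  then obtain z0 y0 where 0: "(z0, y0) \<in> nbhd A r {(x, y')}" "((z0, y0), (z, y)) \<in> gaifman A"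
    by (auto simp: nbhd_Suc)
  have "step d (a, b) (c, e) \<Longrightarrow> a \<le> c + 1 \<and> c \<le> a + 1" for d a b c e
    by (cases d) auto
  then have "z0 \<le> z + 1 \<and> z \<le> z0 + 1"
    using 0(2) unfolding gaifman_def assms(1) by (auto simp: rel_grid)
  then show ?case
    using Suc.IH[OF 0(1)] by simp
qed simp

definition cut_swap :: "nat \<Rightarrow> nat \<Rightarrow> nat \<Rightarrow> nat" where
  "cut_swap p q x = (if x = p then q else if x = q then p else x)"

text \<open>In row \<open>0\<close> the \<open>R\<close>-edges run from \<open>p + 1\<close> to
  \<open>q\<close> and back to \<open>p + 1\<close>, whereas each \<open>R\<close>-edge of a grid
  raises the first coordinate, which excludes directed cycles.\<close>

lemma rewired_not_grid:
  assumes "p < q" "q \<le> xm"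
  shows "\<not> isomorphic (rewired (cut_swap p q) xm ym) (grid xm' ym')"
proof
  assume "isomorphic (rewired (cut_swap p q) xm ym) (grid xm' ym')"
  then obtain e where e0: "\<And>d a b. a \<in> {0..xm} \<times> {0..ym} \<Longrightarrow> b \<in> {0..xm} \<times> {0..ym} \<Longrightarrow>
    (a, b) \<in> rel (rewired (cut_swap p q) xm ym) d \<longleftrightarrow> (e a, e b) \<in> rel (grid xm' ym') d"
    by (auto simp: isomorphic_def univ_rewired)
  then have e: "(e (x, 0), e (x', 0)) \<in> rel (grid xm' ym') R"
    if "x \<le> xm" "x' \<le> xm" "x' = Suc (cut_swap p q x)" for x x'
    using that e0[of "(x, 0)" "(x', 0)" R] by (simp add: rel_rewired)
  have step: "fst (e (x', 0)) = fst (e (x, 0)) + 1"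
    if "x \<le> xm" "x' \<le> xm" "x' = Suc (cut_swap p q x)" for x x'
    using e[OF that] by (cases "e (x, 0)"; cases "e (x', 0)") (auto simp: rel_grid)
  have "i < q - p \<Longrightarrow> fst (e (p + 1 + i, 0)) = fst (e (p + 1, 0)) + i" for i
  proof (induction i)
    case (Suc i)
    then show ?case
      using step[of "p + 1 + i" "p + 1 + Suc i"] assms by (simp add: cut_swap_def)
  qed simp
  from this[of "q - p - 1"] have "fst (e (q, 0)) = fst (e (p + 1, 0)) + (q - p - 1)"
    using assms by simp
  moreover have "fst (e (p + 1, 0)) = fst (e (q, 0)) + 1"
    using assms by (intro step) (auto simp: cut_swap_def)
  ultimately show False
    by simp
qed

text \<open>Exchanging the left halves of the two windows, or their right halves, maps the strip to the
  rewired strip except at the outer ends of these halves. For each column \<open>x\<close> one of the two choices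
  fixes \<open>x\<close> and disturbs no edge near \<open>x\<close>.\<close>

definition block_swap :: "nat \<Rightarrow> nat \<Rightarrow> nat \<Rightarrow> nat \<Rightarrow> nat" where
  "block_swap m k c z =
     (if c \<le> z \<and> z < c + m then z + k else if c + k \<le> z \<and> z < c + k + m then z - k else z)"

lemma block_swap_invol: "m \<le> k \<Longrightarrow> block_swap m k c (block_swap m k c z) = z"
  by (auto simp: block_swap_def)

text \<open>Column \<open>a + n\<close> moves to the other window, and the reconnected edge leads
  back to \<open>a + n + 1\<close>, which stays put. Only the edges entering a left half from
  outside go wrong.\<close>

lemma block_swap_left_Suc:
  assumes "2 * Suc n \<le> k" "Suc z \<notin> {a, a + k}"
  shows "block_swap (Suc n) k a (Suc z) = Suc (cut_swap (a + n) (a + n + k) (block_swap (Suc n) k a z))"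
  using assms by (auto simp: block_swap_def cut_swap_def)

text \<open>Column \<open>p\<close> stays while \<open>p + 1\<close> moves to
  \<open>p + k + 1\<close>, the successor of \<open>p\<close> after reconnection. Only the edges
  leaving a right half go wrong.\<close>

lemma block_swap_right_Suc:
  assumes "2 * Suc n \<le> k" "z \<notin> {p + Suc n, p + Suc n + k}"
  shows "block_swap (Suc n) k (Suc p) (Suc z) =
    Suc (cut_swap p (p + k) (block_swap (Suc n) k (Suc p) z))"
  using assms by (auto simp: block_swap_def cut_swap_def)

text \<open>The exchange is an involution, which turns the successor equation into an equivalence.
  If \<open>Suc z\<close> lies in \<open>{a, a + k}\<close>, then so does the right-hand term of the
  second equation, and the exchange preserves this set; hence both sides are false for any other
  \<open>z'\<close>.\<close>

lemma block_swap_left: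
  assumes "2 * Suc n \<le> k" "Suc z \<notin> {a, a + k} \<or> z' \<notin> {a, a + k}"
  shows "z' = Suc z \<longleftrightarrow>
    block_swap (Suc n) k a z' = Suc (cut_swap (a + n) (a + n + k) (block_swap (Suc n) k a z))"
proof -
  have invol: "block_swap (Suc n) k a (block_swap (Suc n) k a z) = z" for z
    using assms(1) by (intro block_swap_invol) simp
  show ?thesis
  proof (cases "Suc z \<in> {a, a + k}")
    case True
    then have "Suc (cut_swap (a + n) (a + n + k) (block_swap (Suc n) k a z)) \<in> {a, a + k}"
      using assms(1) by (auto simp: block_swap_def cut_swap_def)
    moreover have "block_swap (Suc n) k a y \<in> {a, a + k}" if "y \<in> {a, a + k}" for y
      using assms(1) that by (auto simp: block_swap_def)
    ultimately show ?thesis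
      using True assms(2) invol by metis
  next
    case False
    then show ?thesis
      using block_swap_left_Suc[OF assms(1)] invol by metis
  qed
qed

lemma block_swap_right:
  assumes "2 * Suc n \<le> k"
    "z \<notin> {p + Suc n, p + Suc n + k} \<or> z' \<notin> {Suc (p + Suc n), Suc (p + Suc n + k)}"
  shows "z' = Suc z \<longleftrightarrow>
    block_swap (Suc n) k (Suc p) z' = Suc (cut_swap p (p + k) (block_swap (Suc n) k (Suc p) z))"
proof -
  let ?e = "{Suc (p + Suc n), Suc (p + Suc n + k)}"
  have invol: "block_swap (Suc n) k (Suc p) (block_swap (Suc n) k (Suc p) z) = z" for z
    using assms(1) by (intro block_swap_invol) simp
  show ?thesis
  proof (cases "z \<in> {p + Suc n, p + Suc n + k}")
    case True
    then have "Suc z \<in> ?e"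
      by auto
    have "Suc (cut_swap p (p + k) (block_swap (Suc n) k (Suc p) z)) \<in> ?e"
      using True assms(1) by (auto simp: block_swap_def cut_swap_def)
    moreover have "block_swap (Suc n) k (Suc p) y \<in> ?e" if "y \<in> ?e" for y
      using assms(1) that by (auto simp: block_swap_def)
    ultimately show ?thesis
      using True \<open>Suc z \<in> ?e\<close> assms(2) invol by metis
  next
    case False
    then show ?thesis
      using block_swap_right_Suc[OF assms(1)] invol by metis
  qed
qed

lemma column_map:
  assumes "4 * Suc r \<le> k"
  obtains \<pi> where "\<And>z. \<pi> (\<pi> z) = z" "\<pi> x = x"
    "\<And>z. \<pi> z = z \<or>
      (\<exists>i<2 * Suc r. z = a + i \<and> \<pi> z = a + k + i \<or> z = a + k + i \<and> \<pi> z = a + i)"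
    "\<And>z z'. z \<le> x + r \<and> x \<le> z + r \<or> z' \<le> x + r \<and> x \<le> z' + r \<Longrightarrow>
      z' = Suc z \<longleftrightarrow> \<pi> z' = Suc (cut_swap (a + r) (a + r + k) (\<pi> z))"
proof -
  let ?m = "Suc r" and ?p = "a + r"
  have m: "2 * ?m \<le> k" "?m \<le> k"
    using assms by simp_all
  have moves: "block_swap ?m k c z = z \<or>
    (\<exists>i<2 * ?m. z = a + i \<and> block_swap ?m k c z = a + k + i \<or>
      z = a + k + i \<and> block_swap ?m k c z = a + i)"
    if c: "c = a \<or> c = Suc ?p" for c z
  proof -
    consider "c \<le> z" "z < c + ?m" | "c + k \<le> z" "z < c + k + ?m" | "block_swap ?m k c z = z"
      unfolding block_swap_def by fastforce
    then show ?thesis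
    proof cases
      case 1
      then have "z - a < 2 * ?m \<and> z = a + (z - a) \<and> block_swap ?m k c z = a + k + (z - a)"
        using c by (auto simp: block_swap_def)
      then show ?thesis
        by blast
    next
      case 2
      then have "z - (a + k) < 2 * ?m \<and> z = a + k + (z - (a + k)) \<and>
        block_swap ?m k c z = a + (z - (a + k))"
        using c m by (auto simp: block_swap_def)
      then show ?thesis
        by blast
    qed simp
  qed
  show thesis
  \<comment> \<open>These are exactly the columns within distance \<open>r\<close> of an end of an
    edge disturbed by exchanging the right halves: \<open>?p + ?m\<close>,
    \<open>?p + ?m + 1\<close> and their shifts by \<open>k\<close>. They are more than
    \<open>r\<close> away from the edges into \<open>a\<close> and \<open>a + k\<close>, which the
    other exchange disturbs; to the left of \<open>a + k\<close> this takes the full bound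
    \<open>4 * Suc r \<le> k\<close>.\<close>
  proof (cases "?p < x \<and> x \<le> ?p + ?m + ?m \<or> ?p + k < x \<and> x \<le> ?p + k + ?m + ?m")
    case True
    show thesis
    proof (rule that[of "block_swap ?m k a"])
      show "block_swap ?m k a x = x"
        using assms True by (auto simp: block_swap_def)
      show "z' = Suc z \<longleftrightarrow>
          block_swap ?m k a z' = Suc (cut_swap ?p (?p + k) (block_swap ?m k a z))"
        if near: "z \<le> x + r \<and> x \<le> z + r \<or> z' \<le> x + r \<and> x \<le> z' + r" for z z'
      proof (rule block_swap_left[OF m(1)])
        show "Suc z \<notin> {a, a + k} \<or> z' \<notin> {a, a + k}"
        proof (rule ccontr)
          assume "\<not> ?thesis"
          then consider u where "u \<le> x + r" "x \<le> u + r" "u = a \<or> Suc u = a"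
            | u where "u \<le> x + r" "x \<le> u + r" "u = a + k \<or> Suc u = a + k"
            using near by blast
          then show False
            using assms True by cases auto
        qed
      qed
    qed (use moves block_swap_invol[OF m(2)] in blast)+
  next
    case False
    show thesis
    proof (rule that[of "block_swap ?m k (Suc ?p)"])
      show "block_swap ?m k (Suc ?p) x = x"
        using False by (auto simp: block_swap_def)
      show "z' = Suc z \<longleftrightarrow>
          block_swap ?m k (Suc ?p) z' = Suc (cut_swap ?p (?p + k) (block_swap ?m k (Suc ?p) z))"
        if near: "z \<le> x + r \<and> x \<le> z + r \<or> z' \<le> x + r \<and> x \<le> z' + r" for z z'
      proof (rule block_swap_right[OF m(1)])
        show "z \<notin> {?p + ?m, ?p + ?m + k} \<or> z' \<notin> {Suc (?p + ?m), Suc (?p + ?m + k)}"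
        proof (rule ccontr)
          assume "\<not> ?thesis"
          then consider u where "u \<le> x + r" "x \<le> u + r" "u = ?p + ?m \<or> u = Suc (?p + ?m)"
            | u where "u \<le> x + r" "x \<le> u + r" "u = ?p + ?m + k \<or> u = Suc (?p + ?m + k)"
            using near by blast
          then have "?p < x \<and> x \<le> ?p + ?m + ?m \<or> ?p + k < x \<and> x \<le> ?p + k + ?m + ?m"
            by cases auto
          then show False
            using False by blast
        qed
      qed
    qed (use moves block_swap_invol[OF m(2)] in blast)+
  qed
qed

lemma finite_model_rewired:
  fixes M :: "(nat \<times> nat, 'p) lrud_pred"
  assumes M: "finite_model P \<phi> M" "restriction M = grid xm ym" and \<phi>: "sentence P \<phi>"
    and r: "radius \<phi> = r" and k: "4 * Suc r \<le> k" "a + k + 2 * Suc r \<le> xm"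
    and window: "\<And>i y p. i < 2 * Suc r \<Longrightarrow> y \<le> ym \<Longrightarrow> p \<in> P \<Longrightarrow>
      (a + i, y) \<in> pred M p \<longleftrightarrow> (a + k + i, y) \<in> pred M p"
  obtains N :: "(nat \<times> nat, 'p) lrud_pred" where "finite_model P \<phi> N"
    "restriction N = rewired (cut_swap (a + r) (a + r + k)) xm ym"
proof -
  let ?t = "cut_swap (a + r) (a + r + k)"
  define N where "N = M\<lparr>univ := univ (rewired ?t xm ym), rel := rel (rewired ?t xm ym)\<rparr>"
  have univM: "univ M = {0..xm} \<times> {0..ym}" and relM: "rel M = rel (grid xm ym)"
    using M(2) univ_grid[of xm ym] by (metis restriction_sel)+
  have univN: "univ N = {0..xm} \<times> {0..ym}" and relN: "rel N = rel (rewired ?t xm ym)"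
    by (simp_all add: N_def univ_rewired)
  have strM: "is_structure P M"
    using M(1) by (simp add: finite_model_def)
  have strN: "is_structure P N"
  proof -
    have "pred N = pred M"
      by (simp add: N_def)
    moreover have "rel N d \<subseteq> univ N \<times> univ N" for d
      by (auto simp: relN univN rel_rewired)
    ultimately show ?thesis
      using strM unfolding is_structure_def univM univN by simp
  qed
  have "finite_model P \<phi> N"
  proof (rule hanf[OF M(1) \<phi> strN], unfold r)
    show "finite (univ N)"
      by (simp add: univN)
    \<comment> \<open>No vertex changes its type. The local isomorphism \<open>h\<close> below
      depends on \<open>v\<close> and fixes it.\<close>
    show "bij_betw id (univ M) (univ N)"
      by (simp add: univM univN)
    fix v
    assume v: "v \<in> univ M"
    obtain x y where xy: "v = (x, y)"
      by fastforce
    obtain \<pi> where \<pi>: "\<And>z. \<pi> (\<pi> z) = z" "\<pi> x = x"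
      "\<And>z. \<pi> z = z \<or> (\<exists>i<2 * Suc r. z = a + i \<and> \<pi> z = a + k + i \<or> z = a + k + i \<and> \<pi> z = a + i)"
      "\<And>z z'. z \<le> x + r \<and> x \<le> z + r \<or> z' \<le> x + r \<and> x \<le> z' + r \<Longrightarrow>
        z' = Suc z \<longleftrightarrow> \<pi> z' = Suc (?t (\<pi> z))"
      by (rule column_map[OF k(1), of x a], rule that)
    define h where "h = map_prod \<pi> (id :: nat \<Rightarrow> nat)"
    have le: "\<pi> z \<le> xm" if "z \<le> xm" for z
      using \<pi>(3)[of z] by (elim disjE exE conjE) (use that k(2) in simp_all)
    have le_iff: "\<pi> z \<le> xm \<longleftrightarrow> z \<le> xm" for z
      using le[of z] le[of "\<pi> z"] unfolding \<pi>(1) by blast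
    have h_univ: "h u \<in> univ M \<longleftrightarrow> u \<in> univ M" for u
      using le_iff by (cases u) (simp add: h_def univM)
    have hh: "h (h u) = u" for u
      using \<pi>(1) by (cases u) (simp add: h_def)
    have bij: "bij_betw h (univ M) (univ N)"
      unfolding univN univM[symmetric]
      by (intro bij_betw_byWitness[where f' = h] ballI image_subsetI) (simp_all add: hh h_univ)
    have inj: "\<pi> z = \<pi> z' \<longleftrightarrow> z = z'" for z z'
      using \<pi>(1) by metis
    have "point_iso P r M N v (h v)"
    proof (rule point_iso_global[OF strM strN bij v])
      fix u p
      assume "u \<in> univ M" "p \<in> P"
      moreover obtain z y' where "u = (z, y')"
        by fastforce
      ultimately show "u \<in> pred M p \<longleftrightarrow> h u \<in> pred N p"
        using \<pi>(3)[of z] window by (auto simp: h_def N_def univM)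
    next
      fix u w d
      assume u: "u \<in> univ M" "w \<in> univ M"
        and near: "u \<in> nbhd M (r) {v} \<or> w \<in> nbhd M (r) {v}"
      obtain z y1 z' y2 where zs: "u = (z, y1)" "w = (z', y2)"
        by fastforce
      have near': "z \<le> x + r \<and> x \<le> z + r \<or> z' \<le> x + r \<and> x \<le> z' + r"
        using near nbhd_strip[of M xm ym] unfolding zs xy relM by blast
      \<comment> \<open>\<open>R\<close> and \<open>L\<close> use the column equivalence in the two
        orders of \<open>z\<close> and \<open>z'\<close>; \<open>U\<close> and \<open>D\<close>
        compare columns only for equality, hence the injectivity of \<open>\<pi>\<close>.\<close>
      then have "step d u w \<longleftrightarrow> rewired_step ?t d (h u) (h w)"
        using \<pi>(4)[of z z'] \<pi>(4)[of z' z] inj by (cases d) (auto simp: zs h_def)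
      then show "(u, w) \<in> rel M d \<longleftrightarrow> (h u, h w) \<in> rel N d"
        using u h_univ[of u] h_univ[of w]
        unfolding relM relN rel_grid rel_rewired univM univN by blast
    qed
    moreover have "h v = v"
      using \<pi>(2) by (simp add: xy h_def)
    ultimately show "point_iso P r M N v (id v)"
      by simp
  qed
  moreover have "restriction N = rewired ?t xm ym"
    by (simp add: restriction_def N_def)
  ultimately show thesis
    using that by blast
qed

section \<open>Choice of the windows and the contradiction\<close>

text \<open>Candidate windows start at multiples of \<open>4 * m\<close>, which keeps them apart;
  there is one more start than there are possible patterns of predicates. The length
  \<open>xm\<close> precedes \<open>Q\<close>, as a model is available only once its length is
  fixed.\<close>

lemma repeated_window:
  fixes P :: "'p set" and m ym :: nat
  assumes "finite P"
  obtains xm where "\<And>Q :: 'p \<Rightarrow> (nat \<times> nat) set. \<exists>a k. 4 * m \<le> k \<and> a + k + 2 * m \<le> xm \<and>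
    (\<forall>i<2 * m. \<forall>y\<le>ym. \<forall>p\<in>P. (a + i, y) \<in> Q p \<longleftrightarrow> (a + k + i, y) \<in> Q p)"
proof -
  let ?C = "{..<2 * m} \<times> {..ym} \<times> P"
  let ?n = "card (Pow ?C)"
  have fin: "finite (Pow ?C)"
    using assms by simp
  have "\<exists>a k. 4 * m \<le> k \<and> a + k + 2 * m \<le> 4 * m * ?n + 2 * m \<and>
    (\<forall>i<2 * m. \<forall>y\<le>ym. \<forall>p\<in>P. (a + i, y) \<in> Q p \<longleftrightarrow> (a + k + i, y) \<in> Q p)"
    for Q :: "'p \<Rightarrow> (nat \<times> nat) set"
  proof -
    have windows: ?thesis
      if st: "s + 4 * m \<le> t" "t \<le> 4 * m * ?n"
        "\<And>i y p. i < 2 * m \<Longrightarrow> y \<le> ym \<Longrightarrow> p \<in> P \<Longrightarrow> (s + i, y) \<in> Q p \<longleftrightarrow> (t + i, y) \<in> Q p"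
      for s t
    proof -
      obtain k where k: "t = s + k"
        using st(1) by (metis le_iff_add add.assoc)
      show ?thesis
        by (rule exI[of _ s], rule exI[of _ k]) (use st in \<open>simp add: k\<close>)
    qed
    define colour where "colour j = {(i, y, p) \<in> ?C. (4 * m * j + i, y) \<in> Q p}" for j
    have "colour ` {..?n} \<subseteq> Pow ?C"
      by (auto simp: colour_def)
    then have "\<not> inj_on colour {..?n}"
      using card_inj_on_le[of colour "{..?n}" "Pow ?C"] fin by auto
    then obtain j l where jl: "j \<le> ?n" "l \<le> ?n" "j < l" "colour j = colour l"
      unfolding inj_on_def by (metis atMost_iff linorder_neqE_nat)
    have "4 * m * Suc j \<le> 4 * m * l"
      using jl(3) by (intro mult_le_mono2) simp
    then have "4 * m * j + 4 * m \<le> 4 * m * l"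
      by simp
    moreover have "4 * m * l \<le> 4 * m * ?n"
      using jl(2) by (rule mult_le_mono2)
    moreover have "(4 * m * j + i, y) \<in> Q p \<longleftrightarrow> (4 * m * l + i, y) \<in> Q p"
      if "i < 2 * m" "y \<le> ym" "p \<in> P" for i y p
    proof -
      have "(i, y, p) \<in> colour j \<longleftrightarrow> (i, y, p) \<in> colour l"
        using jl(4) by simp
      then show ?thesis
        using that by (simp add: colour_def)
    qed
    ultimately show ?thesis
      by (rule windows)
  qed
  then show thesis
    using that by blast
qed

lemma not_axiomatizable_strips:
  fixes P :: "'p set"
  assumes "finite P" and inf: "infinite (UNIV :: 'a set)" and \<phi>: "sentence P \<phi>"
    and grids: "\<And>M :: ('a, 'p) lrud_pred. finite_model P \<phi> M \<Longrightarrow>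
      \<exists>xm ym. isomorphic (restriction M) (grid xm ym)"
    and strips: "\<And>xm. \<exists>M :: ('a, 'p) lrud_pred. finite_model P \<phi> M \<and>
      isomorphic (restriction M) (grid xm ym)"
  shows False
proof -
  let ?m = "Suc (radius \<phi>)"
  obtain xm where xm: "\<And>Q :: 'p \<Rightarrow> (nat \<times> nat) set. \<exists>a k. 4 * ?m \<le> k \<and> a + k + 2 * ?m \<le> xm \<and>
    (\<forall>i<2 * ?m. \<forall>y\<le>ym. \<forall>p\<in>P. (a + i, y) \<in> Q p \<longleftrightarrow> (a + k + i, y) \<in> Q p)"
    by (rule repeated_window[OF assms(1), where m = ?m and ym = ym], rule that)
  obtain M :: "('a, 'p) lrud_pred" where "finite_model P \<phi> M" "isomorphic (restriction M) (grid xm ym)"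
    using strips by blast
  moreover have "rel (grid xm ym) d \<subseteq> univ (grid xm ym) \<times> univ (grid xm ym)" for d
    by (auto simp: rel_grid univ_grid)
  ultimately obtain G :: "(nat \<times> nat, 'p) lrud_pred" where
    G: "finite_model P \<phi> G" "restriction G = grid xm ym"
    using finite_model_transport \<phi> by metis
  obtain a k where ak: "4 * ?m \<le> k" "a + k + 2 * ?m \<le> xm"
    "\<And>i y p. i < 2 * ?m \<Longrightarrow> y \<le> ym \<Longrightarrow> p \<in> P \<Longrightarrow> (a + i, y) \<in> pred G p \<longleftrightarrow> (a + k + i, y) \<in> pred G p"
    using xm[of "pred G"] by blast
  let ?W = "rewired (cut_swap (a + radius \<phi>) (a + radius \<phi> + k)) xm ym"
  obtain N :: "(nat \<times> nat, 'p) lrud_pred" where N: "finite_model P \<phi> N" "restriction N = ?W"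
    using finite_model_rewired[OF G \<phi> refl ak] by blast
  have "rel ?W d \<subseteq> univ ?W \<times> univ ?W" for d
    by (auto simp: rel_rewired univ_rewired)
  \<comment> \<open>The hypothesis \<open>grids\<close> speaks only of models over
    \<open>'a\<close>, so the rewired strip is copied there.\<close>
  then obtain B :: "'a lrud" where B: "isomorphic ?W B" "\<And>d. rel B d \<subseteq> univ B \<times> univ B"
    using isomorphic_copy[OF inf, of ?W] by (auto simp: univ_rewired)
  obtain M' :: "('a, 'p) lrud_pred" where "finite_model P \<phi> M'" "restriction M' = B"
    using finite_model_transport[OF N(1) \<phi> _ B(2)] N(2) B(1) by metis
  then obtain xm' ym' where "isomorphic B (grid xm' ym')"
    using grids by metis
  then have "isomorphic ?W (grid xm' ym')"
    using isomorphic_trans B(1) by blast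
  moreover have "\<not> isomorphic ?W (grid xm' ym')"
    using ak by (intro rewired_not_grid) simp_all
  ultimately show False
    by blast
qed

theorem theorem5:
  fixes P :: "'p set"
  assumes "finite P"
    and "infinite (UNIV :: 'a set)"
  shows
    "\<not> (\<exists>\<phi>. sentence P \<phi> \<and>
          (\<forall>M :: ('a, 'p) lrud_pred. finite_model P \<phi> M \<longrightarrow>
             (\<exists>xm ym. isomorphic (restriction M) (grid xm ym))) \<and>
          (\<forall>xm ym. \<exists>M :: ('a, 'p) lrud_pred. finite_model P \<phi> M \<and>
             isomorphic (restriction M) (grid xm ym)))
     \<and>
     \<not> (\<exists>\<phi>. sentence P \<phi> \<and>
          (\<forall>M :: ('a, 'p) lrud_pred. finite_model P \<phi> M \<longrightarrow>
             (\<exists>xm ym. isomorphic (restriction M) (grid xm ym))) \<and>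
          (\<exists>ym. \<forall>xm. \<exists>M :: ('a, 'p) lrud_pred. finite_model P \<phi> M \<and>
             isomorphic (restriction M) (grid xm ym)))"
  using not_axiomatizable_strips[OF assms] by (intro conjI notI; elim exE conjE) metis+

end
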